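(* There exists a function $f:\mathbb{Z}_{>0}\to\mathbb{Z}_{>0}$ such that, for every positive integer $n$, every $n$-BFC-group $G$ with trivial centre ($G$ not assumed finite) is a finite group and satisfies $|G|\le f(n)$.
   Context: A group $G$ is called an $n$-BFC-group if each of its conjugacy classes is finite and contains at most $n$ elements. *)

theory Defs
  imports "HOL-Algebra.Coset"
begin

definition conjugacy_class :: "('a, 'b) monoid_scheme \<Rightarrow> 'a \<Rightarrow> 'a set" where
  "conjugacy_class G x = {g \<otimes>\<^bsub>G\<^esub> x \<otimes>\<^bsub>G\<^esub> inv\<^bsub>G\<^esub> g | g. g \<in> carrier G}"

definition centre :: "('a, 'b) monoid_scheme \<Rightarrow> 'a set" where
  "centre G = {z \<in> carrier G. \<forall>g \<in> carrier G. z \<otimes>\<^bsub>G\<^esub> g = g \<otimes>\<^bsub>G\<^esub> z}"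

definition BFC_group :: "nat \<Rightarrow> ('a, 'b) monoid_scheme \<Rightarrow> bool" where
  "BFC_group n G \<longleftrightarrow> group G \<and>
     (\<forall>x \<in> carrier G. finite (conjugacy_class G x) \<and> card (conjugacy_class G x) \<le> n)"

(* A function f between the positive integers is a nat function with positive values at
   positive arguments; its value at 0 is irrelevant.

   HOL cannot quantify over types below an existential quantifier, so in
   "EX f. order_bound TYPE('a) f" alone, with 'a free, f would be allowed to depend on the
   type carrying the groups. To obtain one f for all groups, assert
     (EX f. order_bound TYPE(nat) f) & (ALL f. order_bound TYPE(nat) f --> order_bound TYPE('a) f)
   with 'a free. The first part contains no type variable, so the f that it yields does not
   depend on 'a; the second part says that this f serves for every carrier type, of any
   cardinality. The second part adds nothing to the uniform existence claim, from which it
   follows: every finite group is isomorphic to one carried by natural numbers. *)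
definition order_bound :: "'a itself \<Rightarrow> (nat \<Rightarrow> nat) \<Rightarrow> bool" where
  "order_bound (_ :: 'a itself) f \<longleftrightarrow>
     (\<forall>n > 0. f n > 0 \<and>
        (\<forall>G :: 'a monoid. BFC_group n G \<and> centre G = {\<one>\<^bsub>G\<^esub>} \<longrightarrow>
           finite (carrier G) \<and> order G \<le> f n))"

end

theory Submission
  imports Defs
begin

text \<open>
  The proof combines the counting argument behind Neumann's theorem on BFC-groups with a short
  commutator computation. For \<open>u\<close>, \<open>g\<close> in \<open>G\<close> write \<open>[u, g]\<close> for
  \<open>u\<^sup>-\<^sup>1 g u g\<^sup>-\<^sup>1\<close>, and \<open>C(F)\<close> for the centralizer of a set \<open>F\<close>.
  In an \<open>n\<close>-BFC-group, \<open>C(F)\<close> has index at most \<open>n ^ card F\<close>, because a coset of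
  it is determined by how its elements conjugate the members of \<open>F\<close>
  (\<open>transversal_of_centralizer\<close>). So it suffices to find a set \<open>F\<close>, of size bounded in
  terms of \<open>n\<close>, whose centralizer lies in the centre of \<open>G\<close>, for then it is trivial.

  Comparing a largest conjugacy class with its translates gives sets \<open>B\<close> and \<open>S\<close> of at
  most \<open>n\<close> and \<open>n\<^sup>2\<close> elements such that \<open>[u, g] \<in> S\<close> for all
  \<open>u \<in> C(B)\<close> and all \<open>g\<close> (\<open>few_commutators\<close>). Let \<open>V = C(B \<union> S)\<close>, let
  \<open>T\<close> be a transversal of \<open>V\<close>, and let \<open>W = C(B \<union> S \<union> T)\<close>. For \<open>w \<in> W\<close>
  and \<open>v \<in> V\<close> the commutator \<open>[w, v]\<close> lies in \<open>S\<close>, so it commutes with \<open>V\<close>;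
  it also commutes with each \<open>t \<in> T\<close>. As \<open>G = T V\<close>, it is central, hence
  trivial. Thus \<open>w\<close> commutes with \<open>V\<close> as well as with \<open>T\<close>, so \<open>w\<close> itself is central
  (\<open>centralizer_central\<close>), and \<open>F = B \<union> S \<union> T\<close> is the required set.

  The resulting bound is the same for every carrier type. That any bound valid for groups of
  natural numbers is valid for all groups then follows by copying the group, now known to be
  finite, to the natural numbers.
\<close>

definition centralizer :: "('a, 'b) monoid_scheme \<Rightarrow> 'a set \<Rightarrow> 'a set" where
  "centralizer G X = {g \<in> carrier G. \<forall>x \<in> X. g \<otimes>\<^bsub>G\<^esub> x = x \<otimes>\<^bsub>G\<^esub> g}"

section \<open>Conjugacy classes and centralizers\<close>

context group
begin

lemma inv_mult_cancel_left [simp]: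
  assumes "x \<in> carrier G" "y \<in> carrier G"
  shows "inv x \<otimes> (x \<otimes> y) = y" and "x \<otimes> (inv x \<otimes> y) = y"
  using assms by (simp_all add: m_assoc [symmetric])

lemma conj_eq_iff_commute:
  assumes "g \<in> carrier G" "x \<in> carrier G"
  shows "g \<otimes> x \<otimes> inv g = x \<longleftrightarrow> g \<otimes> x = x \<otimes> g"
  using assms by (metis inv_closed inv_solve_right m_closed)

lemma conjugacy_class_closed:
  assumes "x \<in> carrier G"
  shows "conjugacy_class G x \<subseteq> carrier G"
  using assms by (auto simp: conjugacy_class_def)

text \<open>
  The family of conjugates \<open>g x g\<^sup>-\<^sup>1\<close>, for \<open>x \<in> F\<close>, determines the left coset of \<open>g\<close>
  modulo the centralizer of \<open>F\<close>, and it ranges over a product of conjugacy classes. One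
  representative for each such family is enough.
\<close>

lemma transversal_of_centralizer:
  assumes "BFC_group n G" "finite F" "F \<subseteq> carrier G"
  obtains T where "T \<subseteq> carrier G" "finite T" "card T \<le> n ^ card F"
    "\<And>g. g \<in> carrier G \<Longrightarrow> \<exists>t \<in> T. \<exists>v \<in> centralizer G F. g = t \<otimes> v"
proof -
  define \<phi> where "\<phi> g = (\<lambda>x\<in>F. g \<otimes> x \<otimes> inv g)" for g
  let ?P = "PiE F (conjugacy_class G)"
  have cls: "finite (conjugacy_class G x)" "card (conjugacy_class G x) \<le> n" if "x \<in> F" for x
    using assms that by (auto simp: BFC_group_def)
  have sub: "\<phi> ` carrier G \<subseteq> ?P"
    by (auto simp: \<phi>_def conjugacy_class_def)
  have finP: "finite ?P"
    using assms(2) cls by (intro finite_PiE) auto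
  have cardP: "card ?P \<le> n ^ card F"
    using cls prod_mono [of F "\<lambda>x. card (conjugacy_class G x)" "\<lambda>_. n"]
    by (simp add: card_PiE assms(2))
  define T where "T = inv_into (carrier G) \<phi> ` \<phi> ` carrier G"
  show ?thesis
  proof
    show "T \<subseteq> carrier G"
      unfolding T_def by (auto intro: inv_into_into)
    show "finite T"
      unfolding T_def using finite_subset [OF sub finP] by blast
    have "card T \<le> card (\<phi> ` carrier G)"
      unfolding T_def using finite_subset [OF sub finP] by (rule card_image_le)
    also have "\<dots> \<le> card ?P"
      by (rule card_mono [OF finP sub])
    finally show "card T \<le> n ^ card F"
      using cardP by simp
  next
    fix g assume g: "g \<in> carrier G"
    define t where "t = inv_into (carrier G) \<phi> (\<phi> g)"
    have t: "t \<in> carrier G" "\<phi> t = \<phi> g" "t \<in> T"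
      using g by (auto simp: t_def T_def inv_into_into f_inv_into_f)
    have "inv t \<otimes> g \<in> centralizer G F"
      unfolding centralizer_def
    proof (intro CollectI conjI ballI)
      fix x assume "x \<in> F"
      then have x: "x \<in> carrier G" and eq: "t \<otimes> x \<otimes> inv t = g \<otimes> x \<otimes> inv g"
        using assms(3) fun_cong [OF t(2), of x] by (auto simp: \<phi>_def)
      have "inv t \<otimes> g \<otimes> x = inv t \<otimes> (g \<otimes> x \<otimes> inv g) \<otimes> g"
        using g t x by (simp add: m_assoc)
      also have "\<dots> = x \<otimes> (inv t \<otimes> g)"
        unfolding eq [symmetric] using g t x by (simp add: m_assoc)
      finally show "inv t \<otimes> g \<otimes> x = x \<otimes> (inv t \<otimes> g)" .
    qed (use g t in simp)
    moreover have "g = t \<otimes> (inv t \<otimes> g)"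
      using g t by simp
    ultimately show "\<exists>t \<in> T. \<exists>v \<in> centralizer G F. g = t \<otimes> v"
      using t(3) by blast
  qed
qed

section \<open>Commutators with the centralizer of a finite set\<close>

text \<open>
  Take \<open>a\<close> with a conjugacy class \<open>a\<^sup>G\<close> of maximal size and let \<open>B\<close> contain, for each conjugate
  of \<open>a\<close>, one element conjugating \<open>a\<close> to it. If \<open>u\<close> commutes with \<open>B\<close>, then conjugating
  \<open>u a\<close> by the elements of \<open>B\<close> already gives all of \<open>u a\<^sup>G\<close>, which by maximality must be the
  whole class of \<open>u a\<close>. So every \<open>g\<close> satisfies
  \<open>(g u g\<^sup>-\<^sup>1) (g a g\<^sup>-\<^sup>1) = u y\<close> with \<open>y\<close> conjugate to \<open>a\<close>, and the
  commutator of \<open>u\<close> and \<open>g\<close> is a quotient of two conjugates of \<open>a\<close>.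
\<close>

lemma few_commutators:
  assumes "BFC_group n G"
  obtains B S where "B \<subseteq> carrier G" "S \<subseteq> carrier G" "finite B" "finite S"
    "card B \<le> n" "card S \<le> n * n"
    "\<And>u g. u \<in> centralizer G B \<Longrightarrow> g \<in> carrier G \<Longrightarrow> inv u \<otimes> (g \<otimes> u \<otimes> inv g) \<in> S"
proof -
  let ?cl = "conjugacy_class G"
  have cls: "finite (?cl x)" "card (?cl x) \<le> n" if "x \<in> carrier G" for x
    using assms that by (auto simp: BFC_group_def)
  obtain a where a: "a \<in> carrier G"
    and max: "\<And>x. x \<in> carrier G \<Longrightarrow> card (?cl x) \<le> card (?cl a)"
    using ex_has_greatest_nat [of "\<lambda>x. x \<in> carrier G" \<one> "\<lambda>x. card (?cl x)" "Suc n"] cls one_closed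
    by (metis le_imp_less_Suc)
  have clG: "?cl a \<subseteq> carrier G"
    by (rule conjugacy_class_closed [OF a])
  have "\<forall>y \<in> ?cl a. \<exists>g. g \<in> carrier G \<and> g \<otimes> a \<otimes> inv g = y"
    by (auto simp: conjugacy_class_def)
  then obtain b where b: "\<And>y. y \<in> ?cl a \<Longrightarrow> b y \<in> carrier G"
    "\<And>y. y \<in> ?cl a \<Longrightarrow> b y \<otimes> a \<otimes> inv (b y) = y"
    by metis
  define B where "B = b ` ?cl a"
  define S where "S = (\<lambda>(y, z). y \<otimes> inv z) ` (?cl a \<times> ?cl a)"
  show ?thesis
  proof
    show "B \<subseteq> carrier G" "S \<subseteq> carrier G"
      using b(1) clG by (auto simp: B_def S_def)
    show "finite B" "finite S"
      using cls(1) [OF a] by (simp_all add: B_def S_def)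
    show "card B \<le> n"
      unfolding B_def using card_image_le [OF cls(1) [OF a], of b] cls(2) [OF a] by linarith
    have "card S \<le> card (?cl a) * card (?cl a)"
      unfolding S_def using card_image_le [of "?cl a \<times> ?cl a"] cls(1) [OF a]
      by (metis card_cartesian_product finite_cartesian_product)
    also have "\<dots> \<le> n * n"
      using cls(2) [OF a] by (rule mult_le_mono) (rule cls(2) [OF a])
    finally show "card S \<le> n * n" .
  next
    fix u g assume "u \<in> centralizer G B" and g: "g \<in> carrier G"
    then have u: "u \<in> carrier G" and comm: "\<And>y. y \<in> ?cl a \<Longrightarrow> u \<otimes> b y = b y \<otimes> u"
      by (auto simp: centralizer_def B_def)
    have sub: "(\<lambda>y. u \<otimes> y) ` ?cl a \<subseteq> ?cl (u \<otimes> a)"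
    proof clarify
      fix y assume y: "y \<in> ?cl a"
      have "u \<otimes> y = u \<otimes> b y \<otimes> a \<otimes> inv (b y)"
        using b [OF y] u a by (metis inv_closed m_assoc m_closed)
      also have "\<dots> = b y \<otimes> (u \<otimes> a) \<otimes> inv (b y)"
        using comm [OF y] b(1) [OF y] u a by (simp add: m_assoc)
      finally show "u \<otimes> y \<in> ?cl (u \<otimes> a)"
        unfolding conjugacy_class_def using b(1) [OF y] by blast
    qed
    have "inj_on (\<lambda>y. u \<otimes> y) (?cl a)"
      using clG u by (intro inj_onI) (metis inv_mult_cancel_left(1) subsetD)
    then have "card ((\<lambda>y. u \<otimes> y) ` ?cl a) = card (?cl a)"
      by (rule card_image)
    then have eq: "(\<lambda>y. u \<otimes> y) ` ?cl a = ?cl (u \<otimes> a)"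
      using card_seteq [OF cls(1) sub] max [of "u \<otimes> a"] u a by simp
    have "g \<otimes> (u \<otimes> a) \<otimes> inv g \<in> ?cl (u \<otimes> a)"
      using g by (auto simp: conjugacy_class_def)
    then obtain y where y: "y \<in> ?cl a" "g \<otimes> (u \<otimes> a) \<otimes> inv g = u \<otimes> y"
      using eq by auto
    \<comment> \<open>Cancelling the conjugate of \<open>a\<close> by \<open>g\<close> isolates the commutator.\<close>
    let ?z = "g \<otimes> a \<otimes> inv g"
    have z: "?z \<in> ?cl a"
      using g by (auto simp: conjugacy_class_def)
    have yG: "y \<in> carrier G"
      using y clG by auto
    have "inv u \<otimes> (g \<otimes> u \<otimes> inv g) = inv u \<otimes> (g \<otimes> (u \<otimes> a) \<otimes> inv g) \<otimes> inv ?z"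
      using g u a by (simp add: m_assoc inv_mult_group)
    also have "\<dots> = y \<otimes> inv ?z"
      unfolding y(2) using u yG g a by (simp add: m_assoc)
    finally show "inv u \<otimes> (g \<otimes> u \<otimes> inv g) \<in> S"
      unfolding S_def using y(1) z by auto
  qed
qed

text \<open>
  The key point is that \<open>c = [w, v]\<close> is fixed under conjugation by each \<open>t \<in> T\<close>. Conjugation
  by \<open>t\<close> fixes \<open>w\<close> and sends \<open>v\<close> to \<open>v s\<close> with \<open>s = [v, t]\<close>. Since \<open>s\<close> lies in
  \<open>S\<close>, it commutes with \<open>w\<close> and drops out: \<open>[w, v s] = [w, v]\<close>.
\<close>

lemma centralizer_central:
  assumes S: "S \<subseteq> carrier G" and T: "T \<subseteq> carrier G"
    and comm_S: "\<And>u g. u \<in> centralizer G B \<Longrightarrow> g \<in> carrier G \<Longrightarrow>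
                   inv u \<otimes> (g \<otimes> u \<otimes> inv g) \<in> S"
    and trans: "\<And>g. g \<in> carrier G \<Longrightarrow> \<exists>t \<in> T. \<exists>v \<in> centralizer G (B \<union> S). g = t \<otimes> v"
    and centre: "centre G = {\<one>}"
  shows "centralizer G (B \<union> S \<union> T) \<subseteq> centre G"
proof
  fix w assume w: "w \<in> centralizer G (B \<union> S \<union> T)"
  then have wG: "w \<in> carrier G"
    by (simp add: centralizer_def)
  have wT: "w \<otimes> t = t \<otimes> w" if "t \<in> T" for t
    using w that by (simp add: centralizer_def)
  have wS: "w \<otimes> s = s \<otimes> w" if "s \<in> S" for s
    using w that by (simp add: centralizer_def)
  have wB: "w \<in> centralizer G B"
    using w by (simp add: centralizer_def)
  have commute_all: "h \<otimes> g = g \<otimes> h"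
    if h: "h \<in> carrier G" and hT: "\<And>t. t \<in> T \<Longrightarrow> h \<otimes> t = t \<otimes> h"
      and hV: "\<And>v. v \<in> centralizer G (B \<union> S) \<Longrightarrow> h \<otimes> v = v \<otimes> h" and g: "g \<in> carrier G"
    for h g
  proof -
    obtain t v where tv: "t \<in> T" "v \<in> centralizer G (B \<union> S)" "g = t \<otimes> v"
      using trans [OF g] by blast
    have "t \<in> carrier G" "v \<in> carrier G"
      using tv T by (auto simp: centralizer_def)
    then show ?thesis
      unfolding tv(3) using hT [OF tv(1)] hV [OF tv(2)] h by (metis m_assoc)
  qed
  have wV: "w \<otimes> v = v \<otimes> w" if v: "v \<in> centralizer G (B \<union> S)" for v
  proof -
    have vG: "v \<in> carrier G" and vB: "v \<in> centralizer G B"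
      using v by (auto simp: centralizer_def)
    define c where "c = inv w \<otimes> (v \<otimes> w \<otimes> inv v)"
    have cS: "c \<in> S" and cG: "c \<in> carrier G"
      using comm_S [OF wB vG] S by (auto simp: c_def)
    have cT: "c \<otimes> t = t \<otimes> c" if t: "t \<in> T" for t
    proof -
      have tG: "t \<in> carrier G"
        using t T by auto
      define s where "s = inv v \<otimes> (t \<otimes> v \<otimes> inv t)"
      have sS: "s \<in> S" and sG: "s \<in> carrier G"
        using comm_S [OF vB tG] S by (auto simp: s_def)
      have vs: "t \<otimes> v \<otimes> inv t = v \<otimes> s"
        using vG tG by (simp add: s_def)
      have twt: "t \<otimes> w \<otimes> inv t = w"
        using wT [OF t] wG tG by (simp add: conj_eq_iff_commute)
      have sws: "s \<otimes> w \<otimes> inv s = w"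
        using wS [OF sS] wG sG by (simp add: conj_eq_iff_commute)
      have "t \<otimes> c \<otimes> inv t =
            inv (t \<otimes> w \<otimes> inv t) \<otimes> ((t \<otimes> v \<otimes> inv t) \<otimes> (t \<otimes> w \<otimes> inv t) \<otimes> inv (t \<otimes> v \<otimes> inv t))"
        using tG vG wG by (simp add: c_def m_assoc inv_mult_group)
      also have "\<dots> = inv w \<otimes> (v \<otimes> (s \<otimes> w \<otimes> inv s) \<otimes> inv v)"
        unfolding twt vs using sG vG wG by (simp add: m_assoc inv_mult_group)
      also have "\<dots> = c"
        by (simp add: sws c_def)
      finally show ?thesis
        using tG cG by (simp add: conj_eq_iff_commute)
    qed
    have cV: "c \<otimes> v' = v' \<otimes> c" if "v' \<in> centralizer G (B \<union> S)" for v'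
      using that cS by (simp add: centralizer_def)
    have "c \<in> centre G"
      using commute_all [OF cG cT cV] cG by (simp add: centre_def)
    then have "c = \<one>"
      by (simp add: centre)
    then have "v \<otimes> w \<otimes> inv v = w"
      using inv_mult_cancel_left(2) [of w "v \<otimes> w \<otimes> inv v"] wG vG by (simp add: c_def)
    then show ?thesis
      using vG wG by (simp add: conj_eq_iff_commute)
  qed
  show "w \<in> centre G"
    using commute_all [OF wG wT wV] wG by (simp add: centre_def)
qed

end

section \<open>The bound\<close>

text \<open>
  The exponent bounds the size of \<open>B \<union> S \<union> T\<close>: its three summands account for \<open>B\<close>,
  for \<open>S\<close>, and for a transversal of the centralizer of \<open>B \<union> S\<close>.
\<close>

definition centreless_bound :: "nat \<Rightarrow> nat" where
  "centreless_bound n = n ^ (n + n * n + n ^ (n + n * n))"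

theorem centreless_BFC_bounded:
  fixes G :: "('a, 'b) monoid_scheme"
  assumes n: "n > 0" and BFC: "BFC_group n G" and centre: "centre G = {\<one>\<^bsub>G\<^esub>}"
  shows "finite (carrier G)" and "order G \<le> centreless_bound n"
proof -
  interpret group G
    using BFC by (simp add: BFC_group_def)
  obtain B S where BS: "B \<subseteq> carrier G" "S \<subseteq> carrier G" "finite B" "finite S"
    "card B \<le> n" "card S \<le> n * n"
    "\<And>u g. u \<in> centralizer G B \<Longrightarrow> g \<in> carrier G \<Longrightarrow> inv\<^bsub>G\<^esub> u \<otimes>\<^bsub>G\<^esub> (g \<otimes>\<^bsub>G\<^esub> u \<otimes>\<^bsub>G\<^esub> inv\<^bsub>G\<^esub> g) \<in> S"
    by (rule few_commutators [OF BFC]) blast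
  have cardBS: "card (B \<union> S) \<le> n + n * n"
    using card_Un_le [of B S] BS(5,6) by linarith
  obtain T where T: "T \<subseteq> carrier G" "finite T" "card T \<le> n ^ card (B \<union> S)"
    "\<And>g. g \<in> carrier G \<Longrightarrow> \<exists>t \<in> T. \<exists>v \<in> centralizer G (B \<union> S). g = t \<otimes>\<^bsub>G\<^esub> v"
    using transversal_of_centralizer [OF BFC, of "B \<union> S"] BS(1-4) by (metis Un_least finite_UnI)
  have trivial: "centralizer G (B \<union> S \<union> T) \<subseteq> {\<one>\<^bsub>G\<^esub>}"
    using centralizer_central [OF BS(2) T(1) BS(7) T(4) centre] centre by simp
  have "card T \<le> n ^ (n + n * n)"
    using T(3) power_increasing [OF cardBS, of n] n by linarith
  then have cardF: "card (B \<union> S \<union> T) \<le> n + n * n + n ^ (n + n * n)"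
    using card_Un_le [of "B \<union> S" T] cardBS by linarith
  \<comment> \<open>A transversal of the trivial subgroup is the whole group.\<close>
  obtain R where R: "R \<subseteq> carrier G" "finite R" "card R \<le> n ^ card (B \<union> S \<union> T)"
    "\<And>g. g \<in> carrier G \<Longrightarrow> \<exists>t \<in> R. \<exists>v \<in> centralizer G (B \<union> S \<union> T). g = t \<otimes>\<^bsub>G\<^esub> v"
    using transversal_of_centralizer [OF BFC, of "B \<union> S \<union> T"] BS(1-4) T(1,2)
    by (metis Un_least finite_UnI)
  have "carrier G \<subseteq> R"
    using R(4) trivial R(1) by fastforce
  then have eq: "carrier G = R"
    using R(1) by simp
  show "finite (carrier G)"
    using R(2) eq by simp
  show "order G \<le> centreless_bound n"
    using R(3) power_increasing [OF cardF, of n] n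
    unfolding order_def eq centreless_bound_def by linarith
qed

section \<open>Independence of the carrier type\<close>

lemma iso_conjugacy_class:
  assumes "group G" "group H" and h: "h \<in> iso G H" and x: "x \<in> carrier G"
  shows "conjugacy_class H (h x) = h ` conjugacy_class G x"
proof -
  interpret group_hom G H h
    using assms by (simp add: group_hom_def group_hom_axioms_def iso_def)
  have "carrier H = h ` carrier G"
    using h by (auto simp: iso_def bij_betw_def)
  then show ?thesis
    using x by (auto simp: conjugacy_class_def image_iff) (metis G.inv_closed G.m_closed hom_inv hom_mult)+
qed

lemma iso_BFC_group:
  assumes "BFC_group n G" "group H" and h: "h \<in> iso G H"
  shows "BFC_group n H"
  unfolding BFC_group_def
proof (intro conjI ballI)
  have G: "group G"
    using assms(1) by (simp add: BFC_group_def)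
  fix y assume "y \<in> carrier H"
  then obtain x where x: "x \<in> carrier G" "y = h x"
    using h by (auto simp: iso_def bij_betw_def)
  have "finite (conjugacy_class G x)" "card (conjugacy_class G x) \<le> n"
    using assms(1) x by (auto simp: BFC_group_def)
  then show "finite (conjugacy_class H y)" "card (conjugacy_class H y) \<le> n"
    using iso_conjugacy_class [OF G assms(2) h x(1)] x(2)
      card_image_le [of "conjugacy_class G x" h] by auto
qed (rule assms(2))

lemma iso_centre:
  assumes "group G" "group H" and h: "h \<in> iso G H"
  shows "centre H = h ` centre G"
proof -
  have hom: "h (x \<otimes>\<^bsub>G\<^esub> y) = h x \<otimes>\<^bsub>H\<^esub> h y" if "x \<in> carrier G" "y \<in> carrier G" for x y
    using h that by (auto simp: iso_def hom_def)
  have H: "carrier H = h ` carrier G" and inj: "inj_on h (carrier G)"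
    using h by (auto simp: iso_def bij_betw_def)
  have "h x \<otimes>\<^bsub>H\<^esub> h y = h y \<otimes>\<^bsub>H\<^esub> h x \<longleftrightarrow> x \<otimes>\<^bsub>G\<^esub> y = y \<otimes>\<^bsub>G\<^esub> x"
    if "x \<in> carrier G" "y \<in> carrier G" for x y
    using that group.is_monoid [OF assms(1)] inj
    by (simp add: hom [symmetric] inj_on_eq_iff monoid.m_closed)
  then show ?thesis
    by (auto simp: centre_def H)
qed

lemma finite_group_iso_on_nat:
  fixes G :: "('a, 'b) monoid_scheme" (structure)
  assumes "group G" and fin: "finite (carrier G)"
  obtains H :: "nat monoid" and h where "group H" "h \<in> iso G H"
proof -
  interpret group G by (rule assms(1))
  obtain h :: "'a \<Rightarrow> nat" where inj: "inj_on h (carrier G)"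
    using finite_imp_inj_to_nat_seg [OF fin] by blast
  define k where "k = inv_into (carrier G) h"
  define H where "H = \<lparr>carrier = h ` carrier G, mult = (\<lambda>i j. h (k i \<otimes> k j)), one = h \<one>\<rparr>"
  have kh [simp]: "k (h x) = x" if "x \<in> carrier G" for x
    using inj that by (simp add: k_def)
  have "h \<in> iso G H"
    using inj by (auto simp: iso_def hom_def H_def bij_betw_def)
  moreover have "group H"
  proof (rule groupI)
    fix i assume "i \<in> carrier H"
    then show "\<exists>j \<in> carrier H. j \<otimes>\<^bsub>H\<^esub> i = \<one>\<^bsub>H\<^esub>"
      by (auto simp: H_def) (metis inv_closed l_inv)
  qed (auto simp: H_def m_assoc)
  ultimately show ?thesis
    using that by blast
qed

theorem corollary2:
  shows "(\<exists>f. order_bound TYPE(nat) f) \<and>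
         (\<forall>f. order_bound TYPE(nat) f \<longrightarrow> order_bound TYPE('a) f)"
proof (intro conjI exI allI impI)
  show "order_bound TYPE(nat) centreless_bound"
    using centreless_BFC_bounded by (auto simp: order_bound_def centreless_bound_def)
next
  fix f assume f: "order_bound TYPE(nat) f"
  show "order_bound TYPE('a) f"
    unfolding order_bound_def
  proof (intro allI impI conjI; (elim conjE)?)
    fix n :: nat assume n: "n > 0"
    show "f n > 0"
      using f n by (simp add: order_bound_def)
    fix G :: "'a monoid" assume BFC: "BFC_group n G" and centre: "centre G = {\<one>\<^bsub>G\<^esub>}"
    show fin: "finite (carrier G)"
      by (rule centreless_BFC_bounded(1) [OF n BFC centre])
    have G: "group G"
      using BFC by (simp add: BFC_group_def)
    obtain H :: "nat monoid" and h where H: "group H" and h: "h \<in> iso G H"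
      by (rule finite_group_iso_on_nat [OF G fin])
    have "centre H = {\<one>\<^bsub>H\<^esub>}"
      using iso_centre [OF G H h] hom_one [of h G H] h G H by (simp add: centre iso_def)
    then have "order H \<le> f n"
      using f n iso_BFC_group [OF BFC H h] by (simp add: order_bound_def)
    moreover have "order G = order H"
      using h by (auto simp: order_def iso_def bij_betw_same_card)
    ultimately show "order G \<le> f n"
      by simp
  qed
qed

end
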